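(* Let $p\equiv 1\pmod 6$ be a prime, $a\in\mathbb{F}_p^*$, and let $E$ be the elliptic curve $y^{2}=x^{3}+a^{3}$ over $\mathbb{F}_p$ with $N_{p,a}=|E(\mathbb{F}_p)|$. If $N_{p,a}\equiv 0\pmod 6$, then the number of points of order $3$ in $E(\mathbb{F}_p)$ is either $2$ or $8$.
   Context: $E(\mathbb{F}_p)$ is the group of $\mathbb{F}_p$-rational points of $E$, including the point at infinity, under the usual addition law. *)

theory Defs
  imports
    "HOL-Algebra.Group"
    "HOL-Number_Theory.Cong"
    "Berlekamp_Zassenhaus.Finite_Field"
begin

datatype 'a point = Infinity | Point 'a 'a

fun on_curve :: "'a::field \<Rightarrow> 'a \<Rightarrow> 'a point \<Rightarrow> bool" where
  "on_curve A B Infinity \<longleftrightarrow> True"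
| "on_curve A B (Point x y) \<longleftrightarrow> y ^ 2 = x ^ 3 + A * x + B"

(* Chord-and-tangent addition on y^2 = x^3 + A x + B. The coefficient B does not occur
   in the formulas. For two affine points of the curve with x1 = x2 one has
   y2 = y1 or y2 = - y1, so the tangent case is reached only for doubling a point with
   y1 different from 0; in characteristic different from 2 the slope is then well defined. *)
fun point_add :: "'a::field \<Rightarrow> 'a point \<Rightarrow> 'a point \<Rightarrow> 'a point" where
  "point_add A Infinity Q = Q"
| "point_add A (Point x1 y1) Infinity = Point x1 y1"
| "point_add A (Point x1 y1) (Point x2 y2) =
    (if x1 = x2 \<and> y1 = - y2 then Infinity
     else let m = (if x1 = x2 then (3 * x1 ^ 2 + A) / (2 * y1)
                   else (y2 - y1) / (x2 - x1));
              x3 = m ^ 2 - x1 - x2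
          in Point x3 (m * (x1 - x3) - y1))"

(* The rational points of the curve over the whole type 'a. This is a group when the
   characteristic is different from 2 and 3 and 4 A^3 + 27 B^2 is nonzero; for A = 0 and
   B = a^3 the latter just says that a is nonzero. *)
definition elliptic_group :: "'a::field \<Rightarrow> 'a \<Rightarrow> 'a point monoid" where
  "elliptic_group A B =
    \<lparr>carrier = {P. on_curve A B P}, monoid.mult = point_add A, one = Infinity\<rparr>"

(* Stated for a bare monoid record: the least positive exponent killing x is n. It agrees with
   group.ord G x = n for n > 0 as soon as G is a group, but does not presuppose that G is one
   (group.ord_def carries this as a premise). *)
definition has_order :: "('a, 'b) monoid_scheme \<Rightarrow> 'a \<Rightarrow> nat \<Rightarrow> bool" where
  "has_order G x n \<longleftrightarrow>
    0 < n \<and> x [^]\<^bsub>G\<^esub> n = \<one>\<^bsub>G\<^esub> \<and>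
    (\<forall>k::nat. 0 < k \<and> k < n \<longrightarrow> x [^]\<^bsub>G\<^esub> k \<noteq> \<one>\<^bsub>G\<^esub>)"

end

theory Submission
  imports Defs
begin

text \<open>
  Write \<open>b = a\<^sup>3\<close>. By the duplication formula, a point \<open>(x, y)\<close> has order 3 iff
  \<open>x (x\<^sup>3 + 4 b) = 0\<close>, that is, \<open>x = 0\<close> and \<open>y\<^sup>2 = b\<close>, or \<open>x\<^sup>3 = - 4 b\<close> and \<open>y\<^sup>2 = - 3 b\<close>.
  As \<open>p \<equiv> 1 (mod 3)\<close>, there is a primitive cube root of unity \<open>w\<close>, hence \<open>- 3 = (2 w + 1)\<^sup>2\<close> is
  a square and every nonzero element has 0 or 3 cube roots. If \<open>b\<close> is a square, this gives
  \<open>2\<close> or \<open>2 + 3 \<cdot> 2\<close> points. If it is not, then \<open>y\<^sup>2 - b\<close> never vanishes, so every \<open>y\<close> is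
  the ordinate of 0 or 3 affine points and the group has order \<open>1\<close> modulo 3.
\<close>

text \<open>With CARD - 1 = 3 q, the polynomial X^q - 1 has at most q roots, fewer than the 3 q
  nonzero elements. So some nonzero x has x^q different from 1, while its cube x^(3 q) is 1 by
  Fermat.\<close>

lemma exists_primitive_cube_root_of_unity:
  assumes "[CARD('a::finite_field) = 1] (mod 3)"
  obtains w :: "'a::finite_field" where "w \<noteq> 1" "w ^ 3 = 1"
proof -
  define q where "q = (CARD('a) - 1) div 3"
  have "card {0, 1 :: 'a} \<le> CARD('a)"
    by (rule card_mono) auto
  hence "CARD('a) > 1" by simp
  moreover have "3 dvd CARD('a) - 1"
    using assms by (metis cong_to_1_nat)
  ultimately have q: "CARD('a) = 3 * q + 1" and "q > 0"
    unfolding q_def by auto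
  define f :: "'a poly" where "f = monom 1 q - 1"
  have "degree f = q"
    unfolding f_def using \<open>q > 0\<close>
    by (subst diff_conv_add_uminus, subst degree_add_eq_left) (auto simp: degree_monom_eq)
  hence "f \<noteq> 0" using \<open>q > 0\<close> by auto
  have "card {x. poly f x = 0} \<le> q"
    using card_poly_roots_bound[OF \<open>f \<noteq> 0\<close>] \<open>degree f = q\<close> by simp
  moreover have "card (UNIV - {0 :: 'a}) = 3 * q"
    using q by (simp add: card_Diff_singleton)
  ultimately have "\<not> UNIV - {0} \<subseteq> {x. poly f x = 0}"
    using card_mono[of "{x. poly f x = 0}" "UNIV - {0}"] \<open>q > 0\<close> by auto
  hence "\<exists>x::'a. x \<noteq> 0 \<and> x ^ q \<noteq> 1"
    by (auto simp: f_def poly_monom)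
  then obtain x :: 'a where "x \<noteq> 0" "x ^ q \<noteq> 1" by blast
  moreover have "(x ^ q) ^ 3 = 1"
  proof -
    have "x * x ^ (3 * q) = x * 1"
      using finite_field_power_card_eq_same[of x] q by simp
    thus ?thesis unfolding mult_left_cancel[OF \<open>x \<noteq> 0\<close>]
      by (metis mult.commute power_mult)
  qed
  ultimately show ?thesis using that by blast
qed

lemma primitive_cube_root_of_unity_sum:
  fixes w :: "'a::field"
  assumes "w \<noteq> 1" "w ^ 3 = 1"
  shows "w ^ 2 + w + 1 = 0"
proof -
  have "(w - 1) * (w ^ 2 + w + 1) = 0"
    using assms(2) by (simp add: algebra_simps power2_eq_square power3_eq_cube)
  thus ?thesis using assms(1) by simp
qed

text \<open>One root x of z^3 = c yields the full factorization with roots x, w x, w^2 x, which are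
  distinct because x is nonzero and w is primitive.\<close>

lemma card_cube_roots:
  fixes w c :: "'a::field"
  assumes w: "w \<noteq> 1" "w ^ 3 = 1" and "c \<noteq> 0"
  shows "card {x. x ^ 3 = c} \<in> {0, 3}"
proof (cases "\<exists>x. x ^ 3 = c")
  case True
  then obtain x where x: "x ^ 3 = c" by blast
  with \<open>c \<noteq> 0\<close> have "x \<noteq> 0" by auto
  have w2: "w ^ 2 = - w - 1"
    using primitive_cube_root_of_unity_sum[OF w]
    by (metis (no_types) add.assoc add_eq_0_iff2 diff_conv_add_uminus minus_add_distrib)
  have "w \<noteq> 0" using w(2) by auto
  have "w ^ 2 \<noteq> 1" using w by (auto simp: power3_eq_cube power2_eq_square)
  have "w ^ 2 \<noteq> w" using w \<open>w \<noteq> 0\<close> by (auto simp: power2_eq_square)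
  have "z ^ 3 = c \<longleftrightarrow> z \<in> {x, w * x, w ^ 2 * x}" for z
  proof -
    have "z ^ 3 - c = (z - x) * (z - w * x) * (z - w ^ 2 * x)"
    proof -
      have "(z - w * x) * (z - w ^ 2 * x) = z ^ 2 - (w + w ^ 2) * (z * x) + w ^ 3 * x ^ 2"
        by (simp add: algebra_simps power2_eq_square power3_eq_cube)
      \<comment> \<open>By \<open>w2\<close>, w + w^2 = -1, so the product is the cofactor of z - x
        in z^3 - x^3.\<close>
      also have "\<dots> = z ^ 2 + z * x + x ^ 2"
        by (simp add: w2 w(2))
      finally show ?thesis
        unfolding x[symmetric] mult.assoc
        by (simp add: algebra_simps power2_eq_square power3_eq_cube)
    qed
    thus ?thesis by auto
  qed
  hence "{x. x ^ 3 = c} = {x, w * x, w ^ 2 * x}" by blast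
  also have "card \<dots> = 3"
    using \<open>x \<noteq> 0\<close> w(1) \<open>w ^ 2 \<noteq> 1\<close> \<open>w ^ 2 \<noteq> w\<close> by (auto simp: card_insert_if)
  finally show ?thesis by simp
qed auto

lemma card_square_roots:
  fixes s :: "'a::field"
  assumes "(2::'a) \<noteq> 0" "s \<noteq> 0"
  shows "card {y. y ^ 2 = s ^ 2} = 2"
proof -
  have "{y. y ^ 2 = s ^ 2} = {s, - s}" by (auto simp: power2_eq_iff)
  moreover have "s \<noteq> - s" using assms by (metis add_eq_0_iff mult_2 mult_eq_0_iff)
  ultimately show ?thesis by simp
qed

lemma has_order_3_iff:
  fixes b :: "'a::field"
  assumes char: "(2::'a) \<noteq> 0" "(3::'a) \<noteq> 0" and "b \<noteq> 0"
    and "on_curve 0 b P"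
  shows "has_order (elliptic_group 0 b) P 3 \<longleftrightarrow>
    (\<exists>x y. P = Point x y \<and> (x = 0 \<or> x ^ 3 = - 4 * b))"
proof -
  let ?add = "point_add 0"
  have less3: "(\<forall>k::nat. 0 < k \<and> k < 3 \<longrightarrow> Q k) \<longleftrightarrow> Q 1 \<and> Q 2" for Q
    by (auto simp: numeral_3_eq_3 numeral_2_eq_2 less_Suc_eq)
  have order: "has_order (elliptic_group 0 b) P 3 \<longleftrightarrow>
      ?add (?add P P) P = Infinity \<and> P \<noteq> Infinity \<and> ?add P P \<noteq> Infinity"
    unfolding has_order_def less3
    by (simp add: elliptic_group_def nat_pow_def numeral_3_eq_3 numeral_2_eq_2)
  show ?thesis
  proof (cases P)
    case Infinity
    show ?thesis unfolding order by (simp add: Infinity)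
  next
    case (Point x y)
    have curve: "y ^ 2 = x ^ 3 + b" using assms(4) Point by simp
    have neg: "y = - y \<longleftrightarrow> y = 0"
      using char(1) by (metis add_eq_0_iff mult_2 mult_eq_0_iff neg_0_equal_iff_equal)
    show ?thesis
    proof (cases "y = 0")
      \<comment> \<open>Here P + P is \<open>Infinity\<close>, so the left side fails. The right
        side fails too: x^3 = -b, hence x = 0 would give b = 0 and x^3 = -4 b would give 3 b =
        0.\<close>
      case True
      have "x \<noteq> 0" using curve True \<open>b \<noteq> 0\<close> by auto
      moreover have "x ^ 3 \<noteq> - 4 * b"
      proof
        assume "x ^ 3 = - 4 * b"
        hence "- 4 * b + b = 0" using curve True by simp
        moreover have "3 * b = - (- 4 * b + b)" by simp
        ultimately have "3 * b = 0" by (simp only: minus_zero)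
        thus False using char(2) \<open>b \<noteq> 0\<close> by simp
      qed
      ultimately show ?thesis unfolding order by (simp add: Point True)
    next
      case False
      define m where "m = 3 * x ^ 2 / (2 * y)"
      have double: "?add P P = Point (m ^ 2 - x - x) (m * (x - (m ^ 2 - x - x)) - y)"
        using False by (simp add: Point neg m_def Let_def)
      \<comment> \<open>P has order 3 iff 2 P = -P. Comparing abscissas suffices: once that of 2 P
        equals x, its ordinate m (x - x) - y is already -y.\<close>
      have "has_order (elliptic_group 0 b) P 3 \<longleftrightarrow> m ^ 2 - x - x = x"
        unfolding order double by (auto simp: Point Let_def)
      also have "\<dots> \<longleftrightarrow> m ^ 2 = 3 * x" by (auto simp: algebra_simps)
      also have "\<dots> \<longleftrightarrow> (3 * x ^ 2) ^ 2 = 3 * x * (2 * y) ^ 2"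
      proof -
        have "(2 * y) ^ 2 \<noteq> 0" using False char(1) by (metis mult_eq_0_iff power_not_zero)
        thus ?thesis unfolding m_def power_divide by (rule nonzero_divide_eq_eq)
      qed
      also have "\<dots> \<longleftrightarrow> 3 * (x * (x ^ 3 + 4 * b)) = 0"
      proof -
        \<comment> \<open>Replacing y^2 by x^3 + b turns the difference into 12 x (x^3 + b) - 9
          x^4.\<close>
        have "3 * x * (2 * y) ^ 2 - (3 * x ^ 2) ^ 2 = 3 * (x * (x ^ 3 + 4 * b))"
          unfolding power_mult_distrib curve
          by (simp add: algebra_simps flip: power_mult power_Suc power_Suc2 power_add)
        thus ?thesis by (metis eq_iff_diff_eq_0)
      qed
      also have "\<dots> \<longleftrightarrow> x = 0 \<or> x ^ 3 = - 4 * b"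
        using char(2) by (simp add: add_eq_0_iff2)
      finally show ?thesis by (simp add: Point)
    qed
  qed
qed

lemma card_curve_cong_1:
  fixes b w :: "'a::{field, finite}"
  assumes w: "w \<noteq> 1" "w ^ 3 = 1" and b: "\<And>s. s ^ 2 \<noteq> b"
  shows "[card (carrier (elliptic_group 0 b)) = 1] (mod 3)"
proof -
  \<comment> \<open>The ordinate comes first, so that the fibres are sets of cube roots of the
    nonzero elements y^2 - b; \<open>Infinity\<close> supplies the remainder 1.\<close>
  let ?A = "SIGMA y:UNIV. {x. x ^ 3 = y ^ 2 - b}"
  have carrier: "carrier (elliptic_group 0 b) = insert Infinity ((\<lambda>(y, x). Point x y) ` ?A)"
  proof (rule Set.set_eqI)
    fix P
    show "P \<in> carrier (elliptic_group 0 b) \<longleftrightarrow> P \<in> insert Infinity ((\<lambda>(y, x). Point x y) ` ?A)"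
      by (cases P) (auto simp: elliptic_group_def image_iff algebra_simps)
  qed
  have "card (carrier (elliptic_group 0 b)) = Suc (card ?A)"
    unfolding carrier
    by (subst card_insert_disjoint) (auto simp del: card_SigmaI intro!: card_image inj_onI)
  also have "card ?A = (\<Sum>y\<in>UNIV. card {x. x ^ 3 = y ^ 2 - b})"
    by simp
  finally have "card (carrier (elliptic_group 0 b)) =
    Suc (\<Sum>y\<in>UNIV. card {x. x ^ 3 = y ^ 2 - b})" .
  moreover have "3 dvd (\<Sum>y\<in>UNIV. card {x. x ^ 3 = y ^ 2 - b})"
  proof (rule dvd_sum)
    fix y
    show "3 dvd card {x. x ^ 3 = y ^ 2 - b}"
      using card_cube_roots[OF w, of "y ^ 2 - b"] b[of y] by auto
  qed
  ultimately show ?thesis by (auto simp: cong_def elim!: dvdE)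
qed

lemma card_order_3_points:
  fixes b w s :: "'a::{field, finite}"
  assumes char: "(2::'a) \<noteq> 0" "(3::'a) \<noteq> 0" and w: "w \<noteq> 1" "w ^ 3 = 1"
    and b: "b = s ^ 2" "b \<noteq> 0"
  shows "card {P \<in> carrier (elliptic_group 0 b). has_order (elliptic_group 0 b) P 3} \<in> {2, 8}"
proof -
  \<comment> \<open>A square root of -3 b, which is the value of y^2 at points with x^3 = -4
    b.\<close>
  define t where "t = (2 * w + 1) * s"
  have t: "t ^ 2 = - 3 * b"
  proof -
    have "t ^ 2 = (4 * (w ^ 2 + w + 1) - 3) * s ^ 2"
      unfolding t_def by (simp add: algebra_simps power2_eq_square)
    thus ?thesis using primitive_cube_root_of_unity_sum[OF w] b(1) by simp
  qed
  have "s \<noteq> 0" "t \<noteq> 0" using b t char by auto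
  have "(4::'a) \<noteq> 0" using char(1) by (metis mult_eq_0_iff numeral_Bit0_eq_double)
  let ?C = "{x. x ^ 3 = - 4 * b}"
  \<comment> \<open>The two pieces are disjoint since 0 is not a cube root of -4 b.\<close>
  let ?A = "({0} \<times> {y. y ^ 2 = s ^ 2}) \<union> (?C \<times> {y. y ^ 2 = t ^ 2})"
  have "{P \<in> carrier (elliptic_group 0 b). has_order (elliptic_group 0 b) P 3} =
      {P. on_curve 0 b P \<and> (\<exists>x y. P = Point x y \<and> (x = 0 \<or> x ^ 3 = - 4 * b))}"
    using has_order_3_iff[OF char b(2)] by (auto simp: elliptic_group_def)
  also have "\<dots> = (\<lambda>(x, y). Point x y) ` ?A"
    unfolding t by (auto simp: image_iff b(1)[symmetric])
  finally have "card {P \<in> carrier (elliptic_group 0 b). has_order (elliptic_group 0 b) P 3} = card ?A"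
    by (simp only:) (auto intro!: card_image inj_onI)
  also have "\<dots> = 2 + card ?C * 2"
    using card_square_roots[OF char(1) \<open>s \<noteq> 0\<close>] card_square_roots[OF char(1) \<open>t \<noteq> 0\<close>]
      \<open>b \<noteq> 0\<close> \<open>(4::'a) \<noteq> 0\<close>
    by (subst card_Un_disjoint) (auto simp: card_cartesian_product)
  finally show ?thesis
    using card_cube_roots[OF w, of "- 4 * b"] \<open>b \<noteq> 0\<close> \<open>(4::'a) \<noteq> 0\<close> by auto
qed

theorem theorem9:
  fixes p :: nat and a :: "'p::prime_card mod_ring"
  assumes "p = CARD('p)" and "prime p" and "[p = 1] (mod 6)"
    and "a \<noteq> 0"
    and "[card (carrier (elliptic_group 0 (a ^ 3))) = 0] (mod 6)"
  shows "card {P \<in> carrier (elliptic_group 0 (a ^ 3)). has_order (elliptic_group 0 (a ^ 3)) P 3}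
           \<in> {2, 8}"
proof -
  have "[p = 1] (mod 3)"
    using assms(3) by (rule cong_dvd_modulus_nat) simp
  then obtain w :: "'p mod_ring" where w: "w \<noteq> 1" "w ^ 3 = 1"
    using exists_primitive_cube_root_of_unity[where 'a = "'p mod_ring"] assms(1)
    by (metis CARD_mod_ring)
  have "p mod 6 = 1" "p \<noteq> 1" using assms(2,3) by (auto simp: cong_def)
  hence "p > 3" by presburger
  hence "\<not> p dvd 2" "\<not> p dvd 3"
    by (simp_all add: nat_dvd_not_less)
  hence "(of_nat 2 :: 'p mod_ring) \<noteq> 0" "(of_nat 3 :: 'p mod_ring) \<noteq> 0"
    using assms(1) of_nat_0_mod_ring_dvd by metis+
  hence char: "(2 :: 'p mod_ring) \<noteq> 0" "(3 :: 'p mod_ring) \<noteq> 0"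
    by simp_all
  \<comment> \<open>The divisibility of the group order enters here: a nonsquare a^3 would make it 1
    modulo 3.\<close>
  have "\<exists>s. a ^ 3 = s ^ 2"
  proof (rule ccontr)
    assume "\<nexists>s. a ^ 3 = s ^ 2"
    hence "[card (carrier (elliptic_group 0 (a ^ 3))) = 1] (mod 3)"
      using card_curve_cong_1[OF w] by metis
    moreover have "[card (carrier (elliptic_group 0 (a ^ 3))) = 0] (mod 3)"
      using assms(5) by (rule cong_dvd_modulus_nat) simp
    ultimately show False by (simp add: cong_def)
  qed
  then obtain s where "a ^ 3 = s ^ 2" by blast
  moreover have "a ^ 3 \<noteq> 0" using assms(4) by simp
  ultimately show ?thesis by (rule card_order_3_points[OF char w])
qed

end
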